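(* Let the integers $P^\ast(n)$, $n\ge 0$, be defined by $\sum_{n\geq 0}P^\ast(n)q^n=f_1^4f_5^4$. Then for all integers $n\geq 0$, \begin{align*} P^\ast(2n+1)&\equiv 0 \pmod 4,\\ P^\ast(4n+3)&\equiv 0 \pmod 8,\\ P^\ast(16n+7)&=0. \end{align*}
   Context: For a positive integer $k$, $f_k:=(q^k;q^k)_\infty=\prod_{i\geq 1}(1-q^{ki})$, regarded as a formal power series in $q$ with integer coefficients. *)

theory Defs
  imports "HOL-Analysis.Analysis" "HOL-Computational_Algebra.Formal_Power_Series" "HOL-Number_Theory.Cong"
begin

text \<open>
  The infinite product is taken in the \<open>X\<close>-adic topology on \<open>int fps\<close>; the index is shifted
  because \<^const>\<open>prodinf\<close> starts at \<open>0\<close>. Only \<open>k > 0\<close> is meaningful: for \<open>k = 0\<close> every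
  factor vanishes and \<^const>\<open>prodinf\<close> is unspecified.
\<close>

definition euler_f :: "nat \<Rightarrow> int fps"
  where "euler_f k = (\<Prod>i. 1 - fps_X ^ (k * Suc i))"

definition Pstar :: "nat \<Rightarrow> int"
  where "Pstar n = fps_nth (euler_f 1 ^ 4 * euler_f 5 ^ 4) n"

lemma euler_f_has_prod:
  assumes "k > 0"
  shows "(\<lambda>i. 1 - fps_X ^ (k * Suc i)) has_prod euler_f k"
proof -
  let ?F = "\<lambda>i. 1 - fps_X ^ (k * Suc i) :: int fps"
  define Q where "Q n = (\<Prod>i\<le>n. ?F i)" for n
  define L where "L = Abs_fps (\<lambda>m. fps_nth (Q m) m)"
  have step: "fps_nth (Q (Suc n)) m = fps_nth (Q n) m" if "m \<le> n" for m n
  proof -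
    have "Suc (Suc n) \<le> k * Suc (Suc n)"
      using assms by (cases k) auto
    with that have lt: "m < k * Suc (Suc n)"
      by linarith
    have "Q (Suc n) = Q n - Q n * fps_X ^ (k * Suc (Suc n))"
      by (simp add: Q_def right_diff_distrib)
    with lt show ?thesis
      by (simp only: fps_sub_nth fps_X_power_mult_right_nth) simp
  qed
  have stable: "fps_nth (Q n) m = fps_nth L m" if "m \<le> n" for m n
    using that by (induction n rule: dec_induct) (simp_all add: L_def step)
  have "Q \<longlonglongrightarrow> L"
    unfolding tendsto_fps_iff
    by (auto simp: eventually_sequentially intro!: tendsto_eventually stable exI)
  moreover have "fps_nth L 0 = 1"
    using assms by (simp add: L_def Q_def)
  then have "L \<noteq> 0"
    by auto
  ultimately have L: "?F has_prod L"
    by (simp add: has_prod_def raw_has_prod_def Q_def[abs_def])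
  then show ?thesis
    unfolding euler_f_def using has_prod_unique[OF L] by simp
qed

end

theory Submission
  imports Defs "HOL-Computational_Algebra.Formal_Laurent_Series"
begin

text \<open>
  Up to a factor \<open>q\<close>, the series \<open>G = f\<^sub>1\<^sup>4 f\<^sub>5\<^sup>4\<close> is the unique newform \<open>\<eta>(z)\<^sup>4 \<eta>(5z)\<^sup>4\<close> of weight \<open>4\<close>
  and level \<open>5\<close>. It is therefore an eigenform of the Hecke operator \<open>T\<^sub>2\<close>, which amounts to the recurrence
  \<open>P\<^sup>*(2n + 1) = -4 P\<^sup>*(n) - 8 P\<^sup>*((n - 1) / 2)\<close>, the last term being absent for even \<open>n\<close>
  (\<open>Pstar_recurrence\<close>). The two congruences and the vanishing on \<open>16 n + 7\<close> follow by applying this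
  recurrence at most three times.

  The recurrence is proved without modular forms, as a \<open>2\<close>-dissection of \<open>G\<close> (\<open>two_dissection\<close>).
  Write \<open>\<phi>(q) = \<Sum>n\<in>\<int>. q^(n\<^sup>2)\<close> and \<open>\<psi>(q) = \<Sum>n\<ge>0. q^(n (n + 1) / 2)\<close>. Gauss's product formulas
  \<open>\<phi>(-q) = f\<^sub>1\<^sup>2 / f\<^sub>2\<close> and \<open>\<psi>(q) = f\<^sub>2\<^sup>2 / f\<^sub>1\<close> translate between Euler products and theta series, and
  two elementary lattice identities, \<open>\<phi>(-q)\<^sup>2 = \<phi>(q\<^sup>2)\<^sup>2 - 4 q \<psi>(q\<^sup>4)\<^sup>2\<close> and
  \<open>\<psi>(q)\<^sup>2 = \<psi>(q\<^sup>2) \<phi>(q)\<close>, dissect \<open>G\<close>. What remains is Ramanujan's identity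
  \<open>\<phi>(q\<^sup>5) \<psi>(q\<^sup>2) - q \<phi>(q) \<psi>(q\<^sup>10) = f\<^sub>1 f\<^sub>5\<close> (\<open>theta_difference\<close>). By Euler's pentagonal number theorem both
  sides are signed counts of representations by the form \<open>u\<^sup>2 + 5 v\<^sup>2\<close>, and they are matched by
  multiplication with \<open>1 + \<surd>-5\<close>, an element of norm \<open>6\<close>, together with one sign-reversing involution.

  The theorems of Euler and Gauss are specialisations of the Jacobi triple product
  (\<open>jacobi_triple_product\<close>), which is obtained as the \<open>X\<close>-adic limit of a finite identity between
  polynomials (\<open>finite_jacobi_triple\<close>).
\<close>

section \<open>Gaussian binomials and the finite triple product\<close>

text \<open>
  The Gaussian binomial coefficient of base \<open>Q\<close>. Of the two Pascal rules the recursion takes the one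
  whose power of \<open>Q\<close> depends on \<open>n - k\<close>, as this is the rule that an additional factor of the triple
  product calls for.
\<close>

primrec qbinom :: "'a::comm_ring_1 \<Rightarrow> nat \<Rightarrow> nat \<Rightarrow> 'a" where
  "qbinom Q 0 k = (if k = 0 then 1 else 0)"
| "qbinom Q (Suc n) k = (case k of 0 \<Rightarrow> 1 | Suc j \<Rightarrow> qbinom Q n (Suc j) + Q ^ (n - j) * qbinom Q n j)"

lemma qbinom_eq_0: "n < k \<Longrightarrow> qbinom Q n k = 0"
  by (induction n arbitrary: k) (auto split: nat.splits)

lemma qbinom_0 [simp]: "qbinom Q n 0 = 1"
  by (cases n) auto

definition qfact :: "'a::comm_ring_1 \<Rightarrow> nat \<Rightarrow> 'a" where
  "qfact Q n = (\<Prod>i<n. 1 - Q ^ Suc i)"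

lemma qfact_0 [simp]: "qfact Q 0 = 1"
  and qfact_Suc: "qfact Q (Suc n) = qfact Q n * (1 - Q ^ Suc n)"
  by (simp_all add: qfact_def)

lemma qbinom_self [simp]: "qbinom Q n n = 1"
  by (induction n) (auto simp: qbinom_eq_0)

text \<open>
  The quotient formula for Gaussian binomials, cleared of denominators so that it makes sense in every
  commutative ring.
\<close>

lemma qfact_mult_qbinom: "qfact Q k * qfact Q l * qbinom Q (k + l) k = qfact Q (k + l)"
proof (induction "k + l" arbitrary: k l)
  case (Suc n)
  show ?case
  proof (cases "k = 0 \<or> l = 0")
    case False
    then obtain k' l' where k: "k = Suc k'" and l: "l = Suc l'"
      using not0_implies_Suc by blast
    have n: "n = k + l'" "n = k' + l"
      using Suc.hyps(2) k l by simp_all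
    have IH1: "qfact Q k * qfact Q l' * qbinom Q n k = qfact Q n"
      using Suc.hyps(1)[of k l'] n by simp
    have IH2: "qfact Q k' * qfact Q l * qbinom Q n k' = qfact Q n"
      using Suc.hyps(1)[of k' l] n by simp
    have "n - k' = l"
      using n by simp
    then have "qbinom Q (k + l) k = qbinom Q n k + Q ^ l * qbinom Q n k'"
      using Suc.hyps(2) k by (simp flip: Suc.hyps(2))
    then have "qfact Q k * qfact Q l * qbinom Q (k + l) k =
        (1 - Q ^ l) * (qfact Q k * qfact Q l' * qbinom Q n k) +
        Q ^ l * (1 - Q ^ k) * (qfact Q k' * qfact Q l * qbinom Q n k')"
      by (simp add: k l qfact_Suc algebra_simps)
    also have "\<dots> = (1 - Q ^ (k + l)) * qfact Q n"
      unfolding IH1 IH2 by (simp add: algebra_simps power_add)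
    also have "\<dots> = qfact Q (k + l)"
      by (simp add: qfact_Suc flip: Suc.hyps(2))
    finally show ?thesis .
  qed auto
qed simp

lemma qbinom_symmetric:
  fixes Q :: "'a :: idom"
  assumes "\<And>n. qfact Q n \<noteq> 0"
  shows "qbinom Q (k + l) k = qbinom Q (k + l) l"
proof -
  have "qfact Q k * qfact Q l * qbinom Q (k + l) k = qfact Q k * qfact Q l * qbinom Q (k + l) l"
    using qfact_mult_qbinom[of Q k l] qfact_mult_qbinom[of Q l k]
    by (simp add: add.commute mult.commute)
  then show ?thesis
    using assms by simp
qed

definition triangle :: "int \<Rightarrow> int" where
  "triangle j = j * (j + 1) div 2"

lemma two_times_triangle: "2 * triangle j = j * (j + 1)"
  by (simp add: triangle_def)

lemma triangle_uminus: "triangle (- j) = triangle j - j"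
proof -
  have "2 * triangle (- j) = 2 * (triangle j - j)"
    unfolding right_diff_distrib two_times_triangle by (simp add: algebra_simps)
  then show ?thesis
    by simp
qed

lemma triangle_Suc: "triangle (j + 1) = triangle j + (j + 1)"
proof -
  have "2 * triangle (j + 1) = 2 * (triangle j + (j + 1))"
    unfolding distrib_left two_times_triangle by (simp add: algebra_simps)
  then show ?thesis
    by simp
qed

lemma triangle_nonneg: "0 \<le> triangle j"
proof -
  have "0 \<le> j * (j + 1)"
    by (cases "0 \<le> j") (auto intro: mult_nonpos_nonpos)
  then show ?thesis
    by (simp add: triangle_def)
qed

text \<open>
  With \<open>x = q z\<close> and \<open>y = q / z\<close> this is the term \<open>z\<^sup>j q^(j\<^sup>2)\<close> of the Jacobi triple product. In the
  variables \<open>x\<close> and \<open>y\<close> (Ramanujan's form) all exponents are natural numbers, so that the identity can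
  be stated and proved in a commutative ring.
\<close>

definition jacobi_term :: "'a::comm_ring_1 \<Rightarrow> 'a \<Rightarrow> int \<Rightarrow> 'a" where
  "jacobi_term x y j = x ^ nat (triangle j) * y ^ nat (triangle (- j))"

lemma jacobi_term_swap: "jacobi_term x y (- j) = jacobi_term y x j"
  by (simp add: jacobi_term_def mult.commute)

text \<open>
  The ratio of consecutive terms is \<open>x (x y)\<^sup>j\<close>; multiplying by the power \<open>(x y) ^ M\<close> keeps
  the identity free of negative exponents.
\<close>

lemma jacobi_term_step:
  assumes "j \<le> int M"
  shows "x * (x * y) ^ M * jacobi_term x y j = (x * y) ^ nat (int M - j) * jacobi_term x y (j + 1)"
proof -
  have t: "triangle (j + 1) = triangle j + (j + 1)" "triangle (- j) = triangle j - j"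
      "triangle (- (j + 1)) = triangle j"
    using triangle_Suc[of j] triangle_uminus[of j] triangle_uminus[of "j + 1"] by auto
  note nn = triangle_nonneg[of "j + 1"] triangle_nonneg[of j] triangle_nonneg[of "- j"]
  have x: "Suc (M + nat (triangle j)) = nat (int M - j) + nat (triangle (j + 1))"
    using t nn assms by linarith
  have y: "M + nat (triangle (- j)) = nat (int M - j) + nat (triangle (- (j + 1)))"
    using t nn assms by linarith
  have "x * (x * y) ^ M * jacobi_term x y j = x ^ Suc (M + nat (triangle j)) * y ^ (M + nat (triangle (- j)))"
    by (simp add: jacobi_term_def power_add power_mult_distrib mult_ac)
  also have "\<dots> = (x * y) ^ nat (int M - j) * jacobi_term x y (j + 1)"
    unfolding x y by (simp only: jacobi_term_def power_add power_mult_distrib mult_ac)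
  finally show ?thesis .
qed

text \<open>
  The expansion of \<open>\<Prod>i<M. (1 + x Q\<^sup>i)\<close> times \<open>\<Prod>i<N. (1 + y Q\<^sup>i)\<close> for \<open>Q = x y\<close>. The summation index
  \<open>j\<close> from \<open>-N\<close> to \<open>M\<close> is shifted to \<open>k = j + N\<close>.
\<close>

definition jacobi_sum :: "'a::comm_ring_1 \<Rightarrow> 'a \<Rightarrow> nat \<Rightarrow> nat \<Rightarrow> 'a" where
  "jacobi_sum x y M N = (\<Sum>k\<le>M + N. qbinom (x * y) (M + N) k * jacobi_term x y (int k - int N))"

lemma jacobi_sum_Suc: "jacobi_sum x y (Suc M) N = (1 + x * (x * y) ^ M) * jacobi_sum x y M N"
proof -
  let ?Q = "x * y" and ?S = "M + N"
  let ?T = "\<lambda>k. jacobi_term x y (int k - int N)"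
  have "jacobi_sum x y (Suc M) N = ?T 0 + (\<Sum>k\<le>?S. qbinom ?Q (Suc ?S) (Suc k) * ?T (Suc k))"
    by (simp add: jacobi_sum_def sum.atMost_Suc_shift del: sum.atMost_Suc qbinom.simps(2))
  also have "\<dots> = ?T 0 + (\<Sum>k\<le>?S. qbinom ?Q ?S (Suc k) * ?T (Suc k)) +
      (\<Sum>k\<le>?S. ?Q ^ (?S - k) * qbinom ?Q ?S k * ?T (Suc k))"
    by (simp add: sum.distrib distrib_right add.assoc)
  also have "?T 0 + (\<Sum>k\<le>?S. qbinom ?Q ?S (Suc k) * ?T (Suc k)) =
      (\<Sum>k\<le>Suc ?S. qbinom ?Q ?S k * ?T k)"
    by (simp add: sum.atMost_Suc_shift del: sum.atMost_Suc)
  also have "\<dots> = jacobi_sum x y M N"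
    by (simp add: jacobi_sum_def qbinom_eq_0)
  also have "(\<Sum>k\<le>?S. ?Q ^ (?S - k) * qbinom ?Q ?S k * ?T (Suc k)) = x * ?Q ^ M * jacobi_sum x y M N"
    unfolding jacobi_sum_def sum_distrib_left
  proof (rule sum.cong)
    fix k assume "k \<in> {..?S}"
    then have "x * ?Q ^ M * ?T k = ?Q ^ (?S - k) * ?T (Suc k)"
      using jacobi_term_step[of "int k - int N" M x y] by (simp add: algebra_simps nat_diff_distrib' of_nat_diff
        flip: of_nat_add nat_minus_as_int)
    then have "qbinom ?Q ?S k * (?Q ^ (?S - k) * ?T (Suc k)) = qbinom ?Q ?S k * (x * ?Q ^ M * ?T k)"
      by simp
    then show "?Q ^ (?S - k) * qbinom ?Q ?S k * ?T (Suc k) =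
        x * ?Q ^ M * (qbinom ?Q ?S k * ?T k)"
      by (simp only: mult_ac)
  qed simp
  finally show ?thesis
    by (simp add: algebra_simps)
qed

lemma jacobi_sum_swap:
  fixes x y :: "'a :: idom"
  assumes "\<And>n. qfact (x * y) n \<noteq> 0"
  shows "jacobi_sum x y M N = jacobi_sum y x N M"
proof -
  let ?S = "M + N"
  have "jacobi_sum x y M N =
      (\<Sum>k\<le>?S. qbinom (x * y) ?S (?S - k) * jacobi_term x y (int (?S - k) - int N))"
    unfolding jacobi_sum_def atMost_atLeast0 by (subst sum.atLeastAtMost_rev) simp
  also have "\<dots> = (\<Sum>k\<le>?S. qbinom (x * y) ?S k * jacobi_term y x (int k - int M))"
  proof (rule sum.cong)
    fix k assume k: "k \<in> {..?S}"
    have "qbinom (x * y) ?S (?S - k) = qbinom (x * y) ?S k"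
      using qbinom_symmetric[OF assms, of k "?S - k"] k by simp
    moreover have "int (?S - k) - int N = - (int k - int M)"
      using k by simp
    ultimately show "qbinom (x * y) ?S (?S - k) * jacobi_term x y (int (?S - k) - int N) =
        qbinom (x * y) ?S k * jacobi_term y x (int k - int M)"
      by (simp only: jacobi_term_swap)
  qed simp
  finally show ?thesis
    by (simp add: jacobi_sum_def ac_simps)
qed

text \<open>
  Pascal's rule adds factors \<open>1 + x Q\<^sup>i\<close> one at a time. The symmetry between \<open>x\<close> and \<open>y\<close> reduces the
  factors \<open>1 + y Q\<^sup>i\<close> to the same step.
\<close>

theorem finite_jacobi_triple:
  fixes x y :: "'a :: idom"
  assumes "\<And>n. qfact (x * y) n \<noteq> 0"
  shows "(\<Prod>i<M. 1 + x * (x * y) ^ i) * (\<Prod>i<N. 1 + y * (x * y) ^ i) = jacobi_sum x y M N"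
proof (induction M)
  case 0
  have "(\<Prod>i<N. 1 + y * (x * y) ^ i) = jacobi_sum y x N 0"
  proof (induction N)
    case 0
    then show ?case by (simp add: jacobi_sum_def jacobi_term_def triangle_def)
  qed (simp add: jacobi_sum_Suc mult.commute)
  then show ?case
    by (simp add: jacobi_sum_swap[OF assms])
qed (simp add: jacobi_sum_Suc mult_ac)

lemma fps_X_power_dvd_iff: "fps_X ^ n dvd F \<longleftrightarrow> (\<forall>m<n. fps_nth F m = 0)"
  for F :: "'a::comm_ring_1 fps"
proof
  assume *: "\<forall>m<n. fps_nth F m = 0"
  have "F = fps_X ^ n * fps_shift n F"
    by (rule fps_ext) (use * in \<open>auto simp: fps_X_power_mult_nth\<close>)
  then show "fps_X ^ n dvd F"
    by (rule dvdI)
qed (auto simp: dvd_def fps_X_power_mult_nth)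

lemma dvd_mult_diff_one:
  fixes d a b :: "'a :: comm_ring_1"
  assumes "d dvd a - 1" "d dvd b - 1"
  shows "d dvd a * b - 1"
proof -
  have "a * b - 1 = (a - 1) * b + (b - 1)"
    by (simp add: algebra_simps)
  then show ?thesis
    using assms by (simp only: dvd_add dvd_mult2)
qed

lemma dvd_prod_diff_one:
  fixes d :: "'a :: comm_ring_1"
  assumes "\<And>i. i \<in> A \<Longrightarrow> d dvd f i - 1"
  shows "d dvd prod f A - 1"
  using assms by (induction A rule: infinite_finite_induct) (auto intro: dvd_mult_diff_one)

lemma qfact_add: "qfact Q (k + l) = qfact Q k * (\<Prod>i<l. 1 - Q ^ Suc (k + i))"
  by (induction l) (simp_all add: qfact_Suc mult.assoc)

lemma dvd_prod_qfact_tail: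
  fixes X Q :: "'a :: comm_ring_1"
  assumes "X dvd Q"
  shows "X ^ Suc k dvd (\<Prod>i<l. 1 - Q ^ Suc (k + i)) - 1"
proof (rule dvd_prod_diff_one)
  fix i
  have "X ^ Suc k dvd X ^ Suc (k + i)"
    by (rule le_imp_power_dvd) simp
  also have "\<dots> dvd Q ^ Suc (k + i)"
    by (rule dvd_power_same[OF assms])
  finally show "X ^ Suc k dvd 1 - Q ^ Suc (k + i) - 1"
    by simp
qed

text \<open>
  As both lower indices tend to infinity, the Gaussian binomial tends to the reciprocal of the infinite
  product of the \<open>1 - Q\<^sup>i\<close>. This is the quantitative version: modulo \<open>X ^ Suc m\<close> every
  factor \<open>1 - Q\<^sup>i\<close> with \<open>i > m\<close> is \<open>1\<close>, so that all factorials in the quotient formula coincide.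
\<close>

lemma qfact_mult_qbinom_cong_one:
  fixes Q :: "'a :: idom"
  assumes "X dvd Q" and nz: "\<And>n. qfact Q n \<noteq> 0" and "m \<le> k" "m \<le> l" "m \<le> N" 
  shows "X ^ Suc m dvd qfact Q N * qbinom Q (k + l) k - 1"
proof -
  define R where "R j i = (\<Prod>r<i. 1 - Q ^ Suc (j + r))" for j i
  have R: "X ^ Suc m dvd R j i - 1" if "m \<le> j" for i j
    using dvd_prod_qfact_tail[OF assms(1), of j i] that le_imp_power_dvd[of "Suc m" "Suc j" X]
    unfolding R_def by (meson Suc_le_mono dvd_trans)
  \<comment> \<open>Each factorial is compared with the common initial part \<open>qfact Q m\<close>.\<close>
  have "qfact Q k * (qfact Q m * R m (l - m) * qbinom Q (k + l) k) = qfact Q k * R k l"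
    using qfact_mult_qbinom[of Q k l] qfact_add[of Q k l] qfact_add[of Q m "l - m"] assms(4)
    by (simp add: R_def mult_ac)
  then have "qfact Q m * R m (l - m) * qbinom Q (k + l) k = R k l"
    using nz by simp
  moreover have "qfact Q N = qfact Q m * R m (N - m)"
    using qfact_add[of Q m "N - m"] assms(5) by (simp add: R_def)
  ultimately have "qfact Q N * qbinom Q (k + l) k - 1 =
      (R k l * R m (N - m) - 1) - (R m (l - m) - 1) * (qfact Q N * qbinom Q (k + l) k)"
    by (simp add: algebra_simps)
  then show ?thesis
    using R[of k l] R[of m "N - m"] R[of m "l - m"] assms(3)
    by (metis dvd_diff dvd_mult2 dvd_mult_diff_one order_refl)
qed

section \<open>Generating functions over index sets\<close>

text \<open>
  The series \<open>\<Sum>i\<in>A. w i q^(e i)\<close>. Exponents are integers so that quadratic forms can be manipulated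
  by ring arithmetic; an index with a negative exponent contributes nothing.
\<close>

definition genfun :: "('i \<Rightarrow> int) \<Rightarrow> ('i \<Rightarrow> int) \<Rightarrow> 'i set \<Rightarrow> int fps" where
  "genfun w e A = Abs_fps (\<lambda>n. \<Sum>i | i \<in> A \<and> e i = int n. w i)"

lemma genfun_nth: "fps_nth (genfun w e A) n = (\<Sum>i | i \<in> A \<and> e i = int n. w i)"
  by (simp add: genfun_def)

text \<open>
  Each exponent is attained finitely often. Without this, a coefficient of \<open>genfun\<close> would be a sum over an
  infinite set and hence \<open>0\<close> by convention.
\<close>

definition finite_levels :: "('i \<Rightarrow> int) \<Rightarrow> 'i set \<Rightarrow> bool" where
  "finite_levels e A \<longleftrightarrow> (\<forall>n::nat. finite {i \<in> A. e i = int n})"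

lemma finite_levelsD: "finite_levels e A \<Longrightarrow> finite {i. i \<in> A \<and> e i = int n}"
  by (simp add: finite_levels_def)

lemma finite_levels_subset:
  assumes "finite_levels e B" "A \<subseteq> B"
  shows "finite_levels e A"
  unfolding finite_levels_def
proof
  fix n
  have "{i \<in> A. e i = int n} \<subseteq> {i \<in> B. e i = int n}"
    using assms(2) by auto
  then show "finite {i \<in> A. e i = int n}"
    using finite_levelsD[OF assms(1)] by (rule finite_subset)
qed

lemma genfun_cong:
  assumes "\<And>i. i \<in> A \<Longrightarrow> w i = w' i" "\<And>i. i \<in> A \<Longrightarrow> e i = e' i"
  shows "genfun w e A = genfun w' e' A"
proof (rule fps_ext)
  fix n
  have "{i. i \<in> A \<and> e i = int n} = {i. i \<in> A \<and> e' i = int n}"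
    using assms(2) by auto
  then show "fps_nth (genfun w e A) n = fps_nth (genfun w' e' A) n"
    unfolding genfun_nth by (intro sum.cong) (auto simp: assms(1))
qed

lemma bij_betw_levels:
  assumes "bij_betw h A B" and "\<And>i. i \<in> A \<Longrightarrow> e' (h i) = e i"
  shows "bij_betw h {i. i \<in> A \<and> e i = n} {i. i \<in> B \<and> e' i = n}"
  using assms unfolding bij_betw_def inj_on_def by auto

text \<open>
  This is how every identity between theta series below is proved: a bijection of the index lattices
  that preserves exponents and weights.
\<close>

lemma genfun_reindex:
  assumes "bij_betw h A B" "\<And>i. i \<in> A \<Longrightarrow> e' (h i) = e i" "\<And>i. i \<in> A \<Longrightarrow> w' (h i) = w i"
  shows "genfun w e A = genfun w' e' B"
  unfolding genfun_def
proof (intro arg_cong[of _ _ Abs_fps] ext)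
  fix n :: nat
  have "(\<Sum>i | i \<in> B \<and> e' i = int n. w' i) = (\<Sum>i | i \<in> A \<and> e i = int n. w' (h i))"
    by (rule sum.reindex_bij_betw[symmetric]) (rule bij_betw_levels, rule assms(1), erule assms(2))
  also have "\<dots> = (\<Sum>i | i \<in> A \<and> e i = int n. w i)"
    by (rule sum.cong) (use assms(3) in auto)
  finally show "(\<Sum>i | i \<in> A \<and> e i = int n. w i) = (\<Sum>i | i \<in> B \<and> e' i = int n. w' i)"
    by simp
qed

lemma finite_levels_reindex:
  assumes "bij_betw h A B" "\<And>i. i \<in> A \<Longrightarrow> e' (h i) = e i"
  shows "finite_levels e A \<longleftrightarrow> finite_levels e' B"
  unfolding finite_levels_def using bij_betw_finite[OF bij_betw_levels[where h = h and A = A and B = B and e = e and e' = e']] assms by blast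

lemma genfun_Un:
  assumes "finite_levels e (A \<union> B)" "A \<inter> B = {}"
  shows "genfun w e (A \<union> B) = genfun w e A + genfun w e B"
proof (rule fps_ext)
  fix n
  have fin: "finite {i. i \<in> A \<and> e i = int n}" "finite {i. i \<in> B \<and> e i = int n}"
    using assms(1) by (auto simp: finite_levels_def intro: finite_subset[rotated])
  have "{i. i \<in> A \<union> B \<and> e i = int n} = {i. i \<in> A \<and> e i = int n} \<union> {i. i \<in> B \<and> e i = int n}"
    by auto
  then show "fps_nth (genfun w e (A \<union> B)) n = fps_nth (genfun w e A + genfun w e B) n"
    using assms(2) fin by (simp add: genfun_nth) (subst sum.union_disjoint, auto)
qed

lemma genfun_uminus: "genfun (\<lambda>i. - w i) e A = - genfun w e A"
  by (rule fps_ext) (simp add: genfun_nth sum_negf)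

lemma genfun_shift:
  assumes "\<And>i. i \<in> A \<Longrightarrow> 0 \<le> e i"
  shows "fps_X ^ k * genfun w e A = genfun w (\<lambda>i. e i + int k) A"
proof (rule fps_ext)
  fix n
  show "fps_nth (fps_X ^ k * genfun w e A) n = fps_nth (genfun w (\<lambda>i. e i + int k) A) n"
    using assms by (fastforce simp: fps_X_power_mult_nth genfun_nth intro: sum.cong sum.neutral)
qed

lemma genfun_dilate:
  assumes "\<And>i. i \<in> A \<Longrightarrow> e' i = int d * e i" and "d > 0"
  shows "genfun w e A oo fps_X ^ d = genfun w e' A"
proof (rule fps_ext)
  fix n
  show "fps_nth (genfun w e A oo fps_X ^ d) n = fps_nth (genfun w e' A) n"
  proof (cases "d dvd n")
    case True
    then obtain m where "n = d * m" ..
    then have "{i. i \<in> A \<and> e i = int m} = {i. i \<in> A \<and> e' i = int n}"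
      using assms by auto
    then show ?thesis
      using assms(2) by (simp add: fps_nth_compose_X_power genfun_nth \<open>n = d * m\<close>)
  next
    case False
    then have *: "{i. i \<in> A \<and> e' i = int n} = {}"
      using assms by auto (metis dvd_triv_left int_dvd_int_iff)
    show ?thesis
      using False unfolding genfun_nth * by (simp add: fps_nth_compose_X_power)
  qed
qed

lemma levels_prod:
  assumes "\<And>i. i \<in> A \<Longrightarrow> 0 \<le> e i" "\<And>j. j \<in> B \<Longrightarrow> 0 \<le> f j"
  shows "{p. p \<in> A \<times> B \<and> e (fst p) + f (snd p) = int n} =
    (\<Union>k\<in>{0..n}. {i. i \<in> A \<and> e i = int k} \<times> {j. j \<in> B \<and> f j = int (n - k)})"
proof safe
  fix i j assume "i \<in> A" "j \<in> B" "e (fst (i, j)) + f (snd (i, j)) = int n"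
  then show "(i, j) \<in> (\<Union>k\<in>{0..n}. {i. i \<in> A \<and> e i = int k} \<times> {j. j \<in> B \<and> f j = int (n - k)})"
    using assms(1)[of i] assms(2)[of j] by (intro UN_I[of "nat (e i)"]) auto
qed auto

lemma finite_levels_prod:
  assumes "\<And>i. i \<in> A \<Longrightarrow> 0 \<le> e i" "\<And>j. j \<in> B \<Longrightarrow> 0 \<le> f j"
    and "finite_levels e A" "finite_levels f B"
  shows "finite_levels (\<lambda>p. e (fst p) + f (snd p)) (A \<times> B)"
  unfolding finite_levels_def
  using assms
  by (subst levels_prod)
     (auto simp: finite_levels_def simp del: of_nat_diff intro!: finite_cartesian_product)

lemma genfun_mult:
  assumes "\<And>i. i \<in> A \<Longrightarrow> 0 \<le> e i" "\<And>j. j \<in> B \<Longrightarrow> 0 \<le> f j"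
    and "finite_levels e A" "finite_levels f B"
  shows "genfun v e A * genfun w f B =
    genfun (\<lambda>p. v (fst p) * w (snd p)) (\<lambda>p. e (fst p) + f (snd p)) (A \<times> B)"
proof (rule fps_ext)
  fix n
  let ?E = "\<lambda>k. {i. i \<in> A \<and> e i = int k}" and ?F = "\<lambda>k. {j. j \<in> B \<and> f j = int k}"
  have "fps_nth (genfun v e A * genfun w f B) n = (\<Sum>k=0..n. \<Sum>p\<in>?E k \<times> ?F (n - k). v (fst p) * w (snd p))"
    by (simp add: fps_mult_nth genfun_nth sum_product sum.cartesian_product case_prod_beta)
  also have "\<dots> = (\<Sum>p\<in>(\<Union>k\<in>{0..n}. ?E k \<times> ?F (n - k)). v (fst p) * w (snd p))"
    using assms(3,4)
    by (intro sum.UNION_disjoint[symmetric] ballI finite_cartesian_product finite_levelsD) auto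
  also have "\<dots> = fps_nth (genfun (\<lambda>p. v (fst p) * w (snd p)) (\<lambda>p. e (fst p) + f (snd p)) (A \<times> B)) n"
    unfolding genfun_nth using assms(1,2) by (subst levels_prod) auto
  finally show "fps_nth (genfun v e A * genfun w f B) n =
    fps_nth (genfun (\<lambda>p. v (fst p) * w (snd p)) (\<lambda>p. e (fst p) + f (snd p)) (A \<times> B)) n" .
qed

lemma genfun_split:
  assumes "finite_levels e A"
  shows "genfun w e A = genfun w e {i \<in> A. P i} + genfun w e {i \<in> A. \<not> P i}"
proof -
  have A: "A = {i \<in> A. P i} \<union> {i \<in> A. \<not> P i}"
    by auto
  show ?thesis
    by (subst A, rule genfun_Un) (use assms in \<open>auto simp flip: A\<close>)
qed

lemma finite_levels_Un:
  assumes "finite_levels e A" "finite_levels e B"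
  shows "finite_levels e (A \<union> B)"
  unfolding finite_levels_def
proof
  fix n
  have "{i \<in> A \<union> B. e i = int n} = {i. i \<in> A \<and> e i = int n} \<union> {i. i \<in> B \<and> e i = int n}"
    by auto
  then show "finite {i \<in> A \<union> B. e i = int n}"
    using assms by (simp add: finite_levelsD)
qed

section \<open>The Jacobi triple product\<close>

lemma tendsto_fps_mult:
  fixes f g :: "'a::comm_ring_1 fps"
  assumes "(F \<longlongrightarrow> f) L" "(G \<longlongrightarrow> g) L"
  shows "((\<lambda>x. F x * G x) \<longlongrightarrow> f * g) L"
  unfolding tendsto_fps_iff
proof
  fix n
  have "eventually (\<lambda>x. \<forall>m\<in>{..n}. fps_nth (F x) m = fps_nth f m) L"
       "eventually (\<lambda>x. \<forall>m\<in>{..n}. fps_nth (G x) m = fps_nth g m) L"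
    using assms unfolding tendsto_fps_iff by (auto intro!: eventually_ball_finite)
  then show "eventually (\<lambda>x. fps_nth (F x * G x) n = fps_nth (f * g) n) L"
    by eventually_elim (simp add: fps_mult_nth)
qed

lemma qfact_X_power_tendsto:
  assumes "k > 0"
  shows "(\<lambda>n. qfact (fps_X ^ k) n) \<longlonglongrightarrow> euler_f k"
proof -
  define F :: "nat \<Rightarrow> int fps" where "F i = 1 - fps_X ^ (k * Suc i)" for i
  have "fps_nth (F i) 0 = 1" for i
    using assms by (simp add: F_def)
  then have "F i \<noteq> 0" for i
    by (metis fps_zero_nth zero_neq_one)
  moreover have "F has_prod euler_f k"
    using euler_f_has_prod[OF assms] by (simp add: F_def[abs_def])
  ultimately have "(\<lambda>n. \<Prod>i\<le>n. F i) \<longlonglongrightarrow> euler_f k"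
    by (simp add: has_prod_def raw_has_prod_def)
  then have "(\<lambda>n. qfact (fps_X ^ k) (Suc n)) \<longlonglongrightarrow> euler_f k"
    by (simp only: qfact_def lessThan_Suc_atMost F_def power_mult)
  then show ?thesis
    by (rule filterlim_sequentially_Suc[THEN iffD1])
qed

lemma qfact_X_power_nz: "qfact (fps_X ^ Suc k) n \<noteq> (0 :: int fps)"
proof -
  have "fps_nth (qfact (fps_X ^ Suc k) n :: int fps) 0 = 1"
    by (induction n) (simp_all add: qfact_Suc)
  then show ?thesis
    by auto
qed

definition jacobi_exp :: "nat \<Rightarrow> nat \<Rightarrow> int \<Rightarrow> int" where
  "jacobi_exp a b j = int a * triangle j + int b * triangle (- j)"

text \<open>
  A linear lower bound for the exponents; it makes theta series well defined and bounds the number of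
  terms below a given degree.
\<close>

lemma abs_le_triangle: "\<bar>j\<bar> \<le> triangle (- j) + 1"
proof -
  have "2 * \<bar>j\<bar> \<le> 2 * triangle (- j) + 2"
  proof (cases "j \<le> 0")
    case True
    then have "0 \<le> j * j" "\<bar>j\<bar> = - j" by simp_all
    moreover have "0 \<le> (j + 1) * j + 2"
      using triangle_nonneg[of j] unfolding triangle_def by (simp add: mult.commute)
    ultimately show ?thesis
      unfolding two_times_triangle by (simp add: algebra_simps)
  next
    case False
    then have "j = 1 \<or> 2 \<le> j" by linarith
    then have "0 \<le> (j - 1) * (j - 2)"
      by auto
    then show ?thesis
      using False unfolding two_times_triangle by (simp add: algebra_simps)
  qed
  then show ?thesis
    by simp
qed

lemma jacobi_exp_nonneg: "0 \<le> jacobi_exp a b j"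
  by (simp add: jacobi_exp_def triangle_nonneg)

lemma abs_le_jacobi_exp:
  assumes "b > 0"
  shows "\<bar>j\<bar> \<le> jacobi_exp a b j + 1"
proof -
  have "1 * triangle (- j) \<le> int b * triangle (- j)" "0 \<le> int a * triangle j"
    using assms by (intro mult_right_mono mult_nonneg_nonneg triangle_nonneg; simp)+
  then show ?thesis
    using abs_le_triangle[of j] by (simp add: jacobi_exp_def)
qed

lemma finite_levels_int:
  assumes "\<And>j. \<bar>j\<bar> \<le> e j + 1"
  shows "finite_levels e (A :: int set)"
  unfolding finite_levels_def
proof
  fix n :: nat
  have "{j \<in> A. e j = int n} \<subseteq> {- int n - 1..int n + 1}"
  proof safe
    fix j assume "e j = int n"
    then show "j \<in> {- int n - 1..int n + 1}"
      using assms[of j] by auto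
  qed
  then show "finite {j \<in> A. e j = int n}"
    by (rule finite_subset) simp
qed

lemma jacobi_term_fps:
  fixes s :: int
  assumes "s * s = 1"
  shows "jacobi_term (fps_const s * fps_X ^ a) (fps_const s * fps_X ^ b) j =
    fps_const (if even j then 1 else s) * fps_X ^ nat (jacobi_exp a b j)"
proof -
  let ?m = "nat (triangle j)" and ?n = "nat (triangle (- j))"
  have pow: "s ^ n = (if even n then 1 else s)" for n
    using assms by (induction n) auto
  have "int (?m + ?n) = j * j"
    using triangle_nonneg[of j] triangle_nonneg[of "- j"] two_times_triangle[of j] triangle_uminus[of j]
    by (simp add: algebra_simps)
  then have par: "even (?m + ?n) \<longleftrightarrow> even j"
    by (metis even_mult_iff even_of_nat)
  have ex: "nat (jacobi_exp a b j) = a * ?m + b * ?n"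
    by (simp add: jacobi_exp_def nat_add_distrib nat_mult_distrib triangle_nonneg)
  have "jacobi_term (fps_const s * fps_X ^ a) (fps_const s * fps_X ^ b) j =
      fps_const s ^ (?m + ?n) * fps_X ^ (a * ?m + b * ?n)"
    by (simp add: jacobi_term_def power_mult_distrib power_add power_mult mult_ac)
  also have "fps_const s ^ (?m + ?n) = fps_const (s ^ (?m + ?n))"
    by simp
  also have "s ^ (?m + ?n) = (if even j then 1 else s)"
    using pow[of "?m + ?n"] par by auto
  finally show ?thesis
    by (simp only: ex)
qed

text \<open>
  The \<open>j\<close>-th coefficient is correct modulo \<open>X ^ (N - \<bar>j\<bar> + 1)\<close>, and the \<open>j\<close>-th term itself is divisible
  by \<open>X ^ (\<bar>j\<bar> - 1)\<close>, so that all errors have degree at least \<open>N\<close>.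
\<close>

lemma jacobi_truncation_cong:
  fixes s :: int and a b N :: nat
  assumes s: "s * s = 1" and b: "b > 0"
  defines "x \<equiv> fps_const s * fps_X ^ a" and "y \<equiv> fps_const s * fps_X ^ b"
  shows "fps_X ^ N dvd
    jacobi_sum x y N N * qfact (x * y) N - (\<Sum>k\<le>N + N. jacobi_term x y (int k - int N))"
proof -
  have xy: "x * y = fps_X ^ (a + b)"
    using s by (simp add: x_def y_def power_add mult_ac)
  have nz: "qfact (x * y) n \<noteq> 0" for n
    using qfact_X_power_nz[of "a + b - 1" n] b by (simp add: xy)
  have dvd: "fps_X dvd x * y"
    using b by (simp add: xy)
  have "jacobi_sum x y N N * qfact (x * y) N - (\<Sum>k\<le>N + N. jacobi_term x y (int k - int N)) =
      (\<Sum>k\<le>N + N. (qfact (x * y) N * qbinom (x * y) (N + N) k - 1) * jacobi_term x y (int k - int N))"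
    by (simp add: jacobi_sum_def sum_distrib_left sum_distrib_right sum_subtractf algebra_simps)
  also have "fps_X ^ N dvd \<dots>"
  proof (rule dvd_sum)
    fix k assume k: "k \<in> {..N + N}"
    define j where "j = int k - int N"
    define m where "m = min k (N + N - k)"
    have "fps_X ^ Suc m dvd qfact (x * y) N * qbinom (x * y) (k + (N + N - k)) k - 1"
      by (rule qfact_mult_qbinom_cong_one[OF dvd nz]) (auto simp: m_def)
    moreover have "fps_X ^ nat (jacobi_exp a b j) dvd jacobi_term x y j"
      unfolding x_def y_def jacobi_term_fps[OF s] by simp
    ultimately have "fps_X ^ (Suc m + nat (jacobi_exp a b j)) dvd
        (qfact (x * y) N * qbinom (x * y) (N + N) k - 1) * jacobi_term x y j"
      using k unfolding power_add by (intro mult_dvd_mono) auto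
    moreover have "N \<le> Suc m + nat (jacobi_exp a b j)"
      using abs_le_jacobi_exp[OF b, of j a] k unfolding j_def m_def by auto
    ultimately show "fps_X ^ N dvd
        (qfact (x * y) N * qbinom (x * y) (N + N) k - 1) * jacobi_term x y (int k - int N)"
      unfolding j_def by (meson le_imp_power_dvd dvd_trans)
  qed
  finally show ?thesis .
qed

text \<open>
  The triple product for \<open>x = s q\<^sup>a\<close>, \<open>y = s q\<^sup>b\<close> with a sign \<open>s\<close>, as a limit of partial products in
  the \<open>X\<close>-adic topology. The case \<open>a = 0\<close>, in which the first factor is \<open>2\<close>, gives the theta series of
  the triangular numbers.
\<close>

theorem jacobi_triple_product:
  fixes s :: int and a b :: nat
  assumes s: "s * s = 1" and b: "b > 0"
  defines "x \<equiv> fps_const s * fps_X ^ a" and "y \<equiv> fps_const s * fps_X ^ b"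
  shows "(\<lambda>N. (\<Prod>i<N. 1 + x * (x * y) ^ i) * (\<Prod>i<N. 1 + y * (x * y) ^ i) * qfact (x * y) N)
    \<longlonglongrightarrow> genfun (\<lambda>j. if even j then 1 else s) (jacobi_exp a b) UNIV"
  unfolding tendsto_fps_iff
proof
  fix m
  have xy: "x * y = fps_X ^ (a + b)"
    using s by (simp add: x_def y_def power_add mult_ac)
  have nz: "qfact (x * y) n \<noteq> 0" for n
    using qfact_X_power_nz[of "a + b - 1" n] b by (simp add: xy)
  have "fps_nth ((\<Prod>i<N. 1 + x * (x * y) ^ i) * (\<Prod>i<N. 1 + y * (x * y) ^ i) * qfact (x * y) N) m =
      fps_nth (genfun (\<lambda>j. if even j then 1 else s) (jacobi_exp a b) UNIV) m" if "m < N" for N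
  proof -
    let ?w = "\<lambda>j. if even j then 1 else s"
    let ?e = "jacobi_exp a b"
    have coeff: "fps_nth (jacobi_term x y j) m = (if ?e j = int m then ?w j else 0)" for j
      using jacobi_exp_nonneg[of a b j] unfolding x_def y_def jacobi_term_fps[OF s]
      by (auto simp: fps_X_power_nth)
    have "fps_nth ((\<Prod>i<N. 1 + x * (x * y) ^ i) * (\<Prod>i<N. 1 + y * (x * y) ^ i) * qfact (x * y) N) m =
        fps_nth (\<Sum>k\<le>N + N. jacobi_term x y (int k - int N)) m"
      using jacobi_truncation_cong[OF s b, of N a] that
      by (simp add: finite_jacobi_triple[OF nz] fps_X_power_dvd_iff flip: x_def y_def)
    also have "\<dots> = (\<Sum>k\<le>N + N. if ?e (int k - int N) = int m then ?w (int k - int N) else 0)"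
      by (simp add: fps_sum_nth coeff)
    also have "\<dots> = (\<Sum>j\<in>{- int N..int N}. if ?e j = int m then ?w j else 0)"
      by (rule sum.reindex_bij_witness[of _ "\<lambda>j. nat (j + int N)" "\<lambda>k. int k - int N"]) auto
    also have "\<dots> = (\<Sum>j | j \<in> {- int N..int N} \<and> ?e j = int m. ?w j)"
      by (rule sum.inter_filter[symmetric]) simp
    also have "{j. j \<in> {- int N..int N} \<and> ?e j = int m} = {j. j \<in> UNIV \<and> ?e j = int m}"
    proof safe
      fix j assume "?e j = int m"
      then show "j \<in> {- int N..int N}"
        using abs_le_jacobi_exp[OF b, of j a] that by auto
    qed auto
    finally show ?thesis
      by (simp only: genfun_nth)
  qed
  then show "eventually (\<lambda>N. fps_nth ((\<Prod>i<N. 1 + x * (x * y) ^ i) *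
      (\<Prod>i<N. 1 + y * (x * y) ^ i) * qfact (x * y) N) m =
      fps_nth (genfun (\<lambda>j. if even j then 1 else s) (jacobi_exp a b) UNIV) m) sequentially"
    by (intro eventually_sequentiallyI[of "Suc m"]) simp
qed

section \<open>Euler products as theta series\<close>

definition alt_sign :: "int \<Rightarrow> int" where
  "alt_sign j = (if even j then 1 else - 1)"

definition square_theta :: "nat \<Rightarrow> int fps" where
  "square_theta k = genfun (\<lambda>_. 1) (\<lambda>j. int k * (j * j)) UNIV"

definition alt_square_theta :: "nat \<Rightarrow> int fps" where
  "alt_square_theta k = genfun alt_sign (\<lambda>j. int k * (j * j)) UNIV"

text \<open>
  Each triangular number is counted twice, for \<open>j\<close> and \<open>- 1 - j\<close>, so this is \<open>2 \<psi>(q\<^sup>k)\<close> in Ramanujan's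
  notation. Summation over all integers makes the lattice bijections below uniform.
\<close>

definition triangle_theta :: "nat \<Rightarrow> int fps" where
  "triangle_theta k = genfun (\<lambda>_. 1) (\<lambda>j. int k * triangle j) UNIV"

lemma triangle_plus: "triangle j + triangle (- j) = j * j"
  using two_times_triangle[of j] triangle_uminus[of j] by (simp add: algebra_simps)

text \<open>
  Euler's pentagonal number theorem: the three families of factors of the triple product are the
  residue classes modulo \<open>3\<close> of the factors of \<open>f\<^sub>k\<close>. The exponent is \<open>k j (3 j + 1) / 2\<close>.
\<close>

lemma euler_f_eq_gf:
  assumes "k > 0"
  shows "euler_f k = genfun alt_sign (\<lambda>j. int k * (j * j + triangle j)) UNIV"
proof -
  define q :: "int fps" where "q = fps_X ^ k"
  define x y where "x = fps_const (- 1) * (fps_X :: int fps) ^ (2 * k)" and "y = fps_const (- 1) * (fps_X :: int fps) ^ k"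
  have xy: "x = - (q ^ 2)" "y = - q" "x * y = q ^ 3"
    by (simp_all add: x_def y_def q_def power_mult[symmetric] power_add[symmetric] numeral_eq_Suc mult.commute
        flip: fps_const_neg)
  have prods: "(\<Prod>i<N. 1 + x * (x * y) ^ i) * (\<Prod>i<N. 1 + y * (x * y) ^ i) * qfact (x * y) N = qfact q (3 * N)" for N
  proof (induction N)
    case (Suc N)
    have "3 * Suc N = Suc (Suc (Suc (3 * N)))"
      by simp
    then have "qfact q (3 * Suc N) = qfact q (3 * N) * (1 - q * (q ^ 3) ^ N) * (1 - q ^ 2 * (q ^ 3) ^ N) * (1 - (q ^ 3) ^ Suc N)"
      using power_mult[of q 3 N]
      by (simp only: qfact_Suc power_Suc) (simp add: power2_eq_square power3_eq_cube mult_ac)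
    then show ?case
      unfolding Suc.IH[symmetric] xy(3) by (simp add: qfact_Suc xy(1,2) mult_ac)
  qed simp
  have "filterlim (\<lambda>N::nat. 3 * N) sequentially sequentially"
    by (intro filterlim_subseq strict_monoI) auto
  then have "(\<lambda>N. qfact q (3 * N)) \<longlonglongrightarrow> euler_f k"
    using filterlim_compose[OF qfact_X_power_tendsto[OF assms]] by (simp add: q_def)
  moreover have "(\<lambda>N. qfact q (3 * N)) \<longlonglongrightarrow>
      genfun (\<lambda>j. if even j then 1 else - 1) (jacobi_exp (2 * k) k) UNIV"
    using jacobi_triple_product[of "- 1" k "2 * k"] assms by (simp only: prods flip: x_def y_def)
  ultimately have "euler_f k = genfun (\<lambda>j. if even j then 1 else - 1) (jacobi_exp (2 * k) k) UNIV"
    by (rule LIMSEQ_unique)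
  also have "\<dots> = genfun alt_sign (\<lambda>j. int k * (j * j + triangle j)) UNIV"
    by (rule genfun_cong) (simp_all add: alt_sign_def jacobi_exp_def algebra_simps flip: triangle_plus)
  finally show ?thesis .
qed

text \<open>
  Gauss: \<open>\<phi>(-q) = f\<^sub>1\<^sup>2 / f\<^sub>2\<close>. The product \<open>f\<^sub>1\<close> splits into its odd-indexed and its even-indexed factors.
\<close>

lemma alt_square_theta_mult_euler_f:
  assumes "k > 0"
  shows "alt_square_theta k * euler_f (2 * k) = euler_f k ^ 2"
proof -
  define q :: "int fps" where "q = fps_X ^ k"
  define x where "x = fps_const (- 1) * (fps_X :: int fps) ^ k"
  have xy: "x = - q" "x * x = q ^ 2" "fps_X ^ (2 * k) = q ^ 2"
    by (simp_all add: x_def q_def power2_eq_square power_add mult_2 flip: fps_const_neg)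
  define J where "J N = (\<Prod>i<N. 1 + x * (x * x) ^ i) * (\<Prod>i<N. 1 + x * (x * x) ^ i) * qfact (x * x) N" for N
  have prods: "(\<Prod>i<N. 1 + x * (x * x) ^ i) * qfact (x * x) N = qfact q (2 * N)" for N
  proof (induction N)
    case (Suc N)
    have "2 * Suc N = Suc (Suc (2 * N))"
      by simp
    then have "qfact q (2 * Suc N) = qfact q (2 * N) * (1 - q * (q ^ 2) ^ N) * (1 - (q ^ 2) ^ Suc N)"
      using power_mult[of q 2 N]
      by (simp only: qfact_Suc power_Suc) (simp add: power2_eq_square mult_ac)
    then show ?case
      unfolding Suc.IH[symmetric] xy(2) by (simp add: qfact_Suc xy(1) mult_ac)
  qed simp
  have "filterlim (\<lambda>N::nat. 2 * N) sequentially sequentially"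
    by (intro filterlim_subseq strict_monoI) auto
  then have "(\<lambda>N. qfact q (2 * N)) \<longlonglongrightarrow> euler_f k"
    using filterlim_compose[OF qfact_X_power_tendsto[OF assms]] by (simp add: q_def)
  then have "(\<lambda>N. qfact q (2 * N) * qfact q (2 * N)) \<longlonglongrightarrow> euler_f k ^ 2"
    unfolding power2_eq_square by (intro tendsto_fps_mult)
  moreover have "J \<longlonglongrightarrow> alt_square_theta k"
  proof -
    have "J \<longlonglongrightarrow> genfun (\<lambda>j. if even j then 1 else - 1) (jacobi_exp k k) UNIV"
      using jacobi_triple_product[of "- 1" k k] assms by (simp add: J_def[abs_def] x_def)
    also have "genfun (\<lambda>j. if even j then 1 else - 1) (jacobi_exp k k) UNIV = alt_square_theta k"
      unfolding alt_square_theta_def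
      by (rule genfun_cong) (simp_all add: alt_sign_def jacobi_exp_def algebra_simps flip: triangle_plus)
    finally show ?thesis .
  qed
  then have "(\<lambda>N. J N * qfact (q ^ 2) N) \<longlonglongrightarrow> alt_square_theta k * euler_f (2 * k)"
    using qfact_X_power_tendsto[of "2 * k"] assms unfolding xy(3) by (intro tendsto_fps_mult) simp_all
  moreover have "J N * qfact (q ^ 2) N = qfact q (2 * N) * qfact q (2 * N)" for N
    unfolding J_def prods[symmetric] by (simp only: xy(2) mult_ac)
  ultimately show ?thesis
    by (metis (no_types, lifting) LIMSEQ_unique ext)
qed

text \<open>
  Gauss: \<open>\<psi>(q) = f\<^sub>2\<^sup>2 / f\<^sub>1\<close>, because \<open>(1 + q\<^sup>i) (1 - q\<^sup>i) = 1 - q^(2 i)\<close>.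
\<close>

lemma triangle_theta_mult_euler_f:
  assumes "k > 0"
  shows "triangle_theta k * euler_f k = 2 * euler_f (2 * k) ^ 2"
proof -
  define q :: "int fps" where "q = fps_X ^ k"
  have q2: "fps_X ^ (2 * k) = q ^ 2"
    by (simp add: q_def power2_eq_square power_add mult_2)
  define H where "H N = (\<Prod>i<N. 1 + q * q ^ i)" for N
  define J where "J N = (\<Prod>i<N. 1 + q ^ i) * H N * qfact q N" for N
  have H: "H N * qfact q N = qfact (q ^ 2) N" for N
  proof (induction N)
    case (Suc N)
    have "(1 + q * q ^ N) * (1 - q ^ Suc N) = 1 - (q ^ 2) ^ Suc N"
      by (simp add: algebra_simps power2_eq_square power_mult_distrib)
    then show ?case
      unfolding qfact_Suc Suc.IH[symmetric] by (simp add: H_def mult_ac)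
  qed (simp add: H_def)
  \<comment> \<open>The factor \<open>i = 0\<close> of the first product is \<open>2\<close>; stopping one step later than \<open>H\<close> keeps the
    remaining factors aligned.\<close>
  have "J (Suc N) * qfact q N = 2 * (qfact (q ^ 2) N * qfact (q ^ 2) (Suc N))" for N
  proof -
    have "(\<Prod>i<Suc N. 1 + q ^ i) = 2 * H N"
      unfolding prod.lessThan_Suc_shift by (simp add: H_def)
    then show ?thesis
      by (simp only: J_def H[symmetric] mult_ac)
  qed
  moreover have "J \<longlonglongrightarrow> triangle_theta k"
  proof -
    have "J \<longlonglongrightarrow> genfun (\<lambda>j. if even j then 1 else 1) (jacobi_exp 0 k) UNIV"
      using jacobi_triple_product[of 1 k 0] assms by (simp add: J_def[abs_def] H_def q_def)
    also have "genfun (\<lambda>j. if even j then 1 else 1) (jacobi_exp 0 k) UNIV = triangle_theta k"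
      unfolding triangle_theta_def
      by (rule genfun_reindex[of uminus]) (auto simp: jacobi_exp_def intro: bij_uminus)
    finally show ?thesis .
  qed
  then have "(\<lambda>N. J (Suc N)) \<longlonglongrightarrow> triangle_theta k"
    by (rule LIMSEQ_Suc)
  then have "(\<lambda>N. J (Suc N) * qfact q N) \<longlonglongrightarrow> triangle_theta k * euler_f k"
    using qfact_X_power_tendsto[OF assms] unfolding q_def[symmetric] by (intro tendsto_fps_mult)
  moreover have "(\<lambda>N. 2 * (qfact (q ^ 2) N * qfact (q ^ 2) (Suc N))) \<longlonglongrightarrow> 2 * euler_f (2 * k) ^ 2"
    using qfact_X_power_tendsto[of "2 * k"] assms unfolding q2 power2_eq_square[of "euler_f _"]
    by (intro tendsto_fps_mult tendsto_const LIMSEQ_Suc) simp_all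
  ultimately show ?thesis
    by (metis (no_types, lifting) LIMSEQ_unique ext)
qed

section \<open>Quadratic identities between theta series\<close>

lemma abs_le_square: "\<bar>j\<bar> \<le> j * j + 1" for j :: int
proof -
  have "0 \<le> (\<bar>j\<bar> - 1) * (\<bar>j\<bar> - 1)" "\<bar>j\<bar> * \<bar>j\<bar> = j * j"
    by simp_all
  then have "2 * \<bar>j\<bar> \<le> j * j + 1"
    by (simp add: algebra_simps)
  then show ?thesis
    by linarith
qed

lemma abs_le_triangle_pos: "\<bar>j\<bar> \<le> triangle j + 1"
  using abs_le_triangle[of "- j"] by simp

lemma mult_nat_ge:
  assumes "k > 0" "0 \<le> t" 
  shows "t \<le> int k * t"
  using mult_right_mono[of 1 "int k" t] assms by simp

lemma levels_square:
  assumes "k > 0"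
  shows "finite_levels (\<lambda>j. int k * (j * j)) A"
  by (rule finite_levels_int) (use mult_nat_ge[OF assms] abs_le_square in \<open>meson add_mono order_refl order_trans zero_le_square\<close>)

lemma levels_triangle:
  assumes "k > 0"
  shows "finite_levels (\<lambda>j. int k * triangle j) A"
  by (rule finite_levels_int) (use mult_nat_ge[OF assms triangle_nonneg] abs_le_triangle_pos in \<open>meson add_mono order_refl order_trans\<close>)

lemma levels_pentagonal:
  assumes "k > 0"
  shows "finite_levels (\<lambda>j. int k * (j * j + triangle j)) A"
proof (rule finite_levels_int)
  fix j :: int
  have "triangle j \<le> j * j + triangle j" by simp
  also have "\<dots> \<le> int k * (j * j + triangle j)"
    by (rule mult_nat_ge[OF assms]) (simp add: triangle_nonneg)
  finally show "\<bar>j\<bar> \<le> int k * (j * j + triangle j) + 1"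
    using abs_le_triangle_pos[of j] by linarith
qed

lemma genfun_mult_UNIV:
  assumes "\<And>i. 0 \<le> e i" "\<And>j. 0 \<le> f j" "finite_levels e UNIV" "finite_levels f UNIV"
  shows "genfun v e UNIV * genfun w f UNIV = genfun (\<lambda>(i, j). v i * w j) (\<lambda>(i, j). e i + f j) UNIV"
    and "finite_levels (\<lambda>(i, j). e i + f j) UNIV"
  using genfun_mult[of UNIV e UNIV f v w] finite_levels_prod[of UNIV e UNIV f] assms
  by (simp_all add: case_prod_unfold)

lemma bij_even_sum: "bij_betw (\<lambda>(u, v). (u + v, u - v)) UNIV {(i, j). even (i + j :: int)}"
  by (rule bij_betw_byWitness[where f' = "\<lambda>(i, j). ((i + j) div 2, (i - j) div 2)"]) (auto, presburger+)

lemma bij_odd_sum: "bij_betw (\<lambda>(u, v). (u + v + 1, u - v)) UNIV {(i, j). odd (i + j :: int)}"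
  by (rule bij_betw_byWitness[where f' = "\<lambda>(i, j). ((i + j) div 2, (i - j) div 2)"]) (auto, presburger+)

text \<open>
  The parity of \<open>i + j\<close> splits \<open>\<int>\<^sup>2\<close> into two cosets of the lattice spanned by \<open>(1, 1)\<close> and \<open>(1, -1)\<close>, on
  which \<open>i\<^sup>2 + j\<^sup>2\<close> is again diagonal. For \<open>k = 1\<close> this is \<open>\<phi>(-q)\<^sup>2 = \<phi>(q\<^sup>2)\<^sup>2 - 4 q \<psi>(q\<^sup>4)\<^sup>2\<close>, the
  \<open>2\<close>-dissection of \<open>\<phi>(-q)\<^sup>2\<close>.
\<close>

lemma alt_square_theta_power2:
  assumes "k > 0"
  shows "alt_square_theta k ^ 2 = square_theta (2 * k) ^ 2 - fps_X ^ k * triangle_theta (4 * k) ^ 2"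
proof -
  let ?e = "\<lambda>(i, j). int k * (i * i) + int k * (j * j)"
  let ?w = "\<lambda>(i, j). alt_sign i * alt_sign j"
  have sq: "alt_square_theta k ^ 2 = genfun ?w ?e UNIV" and fin: "finite_levels ?e UNIV"
    unfolding alt_square_theta_def power2_eq_square
    by (intro genfun_mult_UNIV levels_square[OF assms]; simp)+
  have "square_theta (2 * k) ^ 2 =
      genfun (\<lambda>(i, j). 1) (\<lambda>(i, j). int (2 * k) * (i * i) + int (2 * k) * (j * j)) UNIV"
    unfolding square_theta_def power2_eq_square using assms
    by (subst genfun_mult_UNIV(1)) (auto intro!: levels_square simp del: of_nat_mult)
  also have "\<dots> = genfun ?w ?e {(i, j). even (i + j)}"
    by (rule genfun_reindex[OF bij_even_sum]) (auto simp: alt_sign_def algebra_simps)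
  finally have even: "genfun ?w ?e {(i, j). even (i + j)} = square_theta (2 * k) ^ 2" ..
  have "fps_X ^ k * triangle_theta (4 * k) ^ 2 = fps_X ^ k *
      genfun (\<lambda>(i, j). 1) (\<lambda>(i, j). int (4 * k) * triangle i + int (4 * k) * triangle j) UNIV"
    unfolding triangle_theta_def power2_eq_square using assms
    by (subst genfun_mult_UNIV(1)) (auto intro!: levels_triangle simp: triangle_nonneg simp del: of_nat_mult)
  also have "\<dots> = genfun (\<lambda>(i, j). 1) (\<lambda>p. (case p of (i, j) \<Rightarrow>
      int (4 * k) * triangle i + int (4 * k) * triangle j) + int k) UNIV"
    by (rule genfun_shift) (auto simp: triangle_nonneg)
  also have "\<dots> = genfun (\<lambda>p. - ?w p) ?e {(i, j). odd (i + j)}"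
  proof (rule genfun_reindex[OF bij_odd_sum])
    fix p :: "int \<times> int"
    obtain u v where p: "p = (u, v)" by fastforce
    have "int (4 * k) * triangle u + int (4 * k) * triangle v + int k =
        int k * (2 * (2 * triangle u) + 2 * (2 * triangle v) + 1)"
      by (simp add: algebra_simps)
    then show "?e (case p of (u, v) \<Rightarrow> (u + v + 1, u - v)) =
        (case p of (i, j) \<Rightarrow> int (4 * k) * triangle i + int (4 * k) * triangle j) + int k"
      unfolding two_times_triangle by (simp add: p algebra_simps)
  qed (auto simp: alt_sign_def)
  finally have odd: "genfun ?w ?e {(i, j). odd (i + j)} = - (fps_X ^ k * triangle_theta (4 * k) ^ 2)"
    by (simp add: genfun_uminus)
  have *: "genfun ?w ?e UNIV = genfun ?w ?e {(i, j). even (i + j)} + genfun ?w ?e {(i, j). odd (i + j)}"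
    using genfun_split[OF fin, of ?w "\<lambda>(i, j). even (i + j)"] by (simp add: case_prod_unfold)
  then show ?thesis
    unfolding sq * even odd by simp
qed

lemma triangle_sum_diff: "triangle (u + v) + triangle (u - v) = 2 * triangle u + v * v"
proof -
  have "2 * (triangle (u + v) + triangle (u - v)) = 2 * (2 * triangle u + v * v)"
    unfolding distrib_left two_times_triangle by (simp add: algebra_simps)
  then show ?thesis
    by simp
qed

lemma triangle_reflect: "triangle (- 1 - j) = triangle j"
  by (simp add: triangle_def algebra_simps)

text \<open>
  \<open>\<psi>(q)\<^sup>2 = \<psi>(q\<^sup>2) \<phi>(q)\<close>. The two cosets contribute equally, since \<open>j \<mapsto> - 1 - j\<close> changes the parity of
  \<open>i + j\<close> and fixes the exponent.
\<close>

lemma triangle_theta_power2: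
  assumes "k > 0"
  shows "triangle_theta k ^ 2 = 2 * triangle_theta (2 * k) * square_theta k"
proof -
  let ?e = "\<lambda>(i, j). int k * triangle i + int k * triangle j"
  let ?w = "\<lambda>(i, j). 1 * 1 :: int"
  have sq: "triangle_theta k ^ 2 = genfun ?w ?e UNIV" and fin: "finite_levels ?e UNIV"
    unfolding triangle_theta_def power2_eq_square
    by (intro genfun_mult_UNIV levels_triangle[OF assms]; simp add: triangle_nonneg)+
  have "triangle_theta (2 * k) * square_theta k =
      genfun (\<lambda>(i, j). 1) (\<lambda>(i, j). int (2 * k) * triangle i + int k * (j * j)) UNIV"
    unfolding square_theta_def triangle_theta_def using assms
    by (subst genfun_mult_UNIV(1)) (auto intro!: levels_square levels_triangle simp: triangle_nonneg simp del: of_nat_mult)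
  also have "\<dots> = genfun ?w ?e {(i, j). even (i + j)}"
  proof (rule genfun_reindex[OF bij_even_sum])
    fix p :: "int \<times> int"
    obtain u v where p: "p = (u, v)" by fastforce
    show "?e (case p of (u, v) \<Rightarrow> (u + v, u - v)) =
        (case p of (i, j) \<Rightarrow> int (2 * k) * triangle i + int k * (j * j))"
      using triangle_sum_diff[of u v] by (simp add: p flip: distrib_left) (simp add: algebra_simps)
  qed auto
  finally have even: "genfun ?w ?e {(i, j). even (i + j)} = triangle_theta (2 * k) * square_theta k" ..
  have "bij_betw (\<lambda>(i, j). (i, - 1 - j)) {(i, j). even (i + j)} {(i, j). odd (i + j :: int)}"
    by (rule bij_betw_byWitness[where f' = "\<lambda>(i, j). (i, - 1 - j)"]) auto
  then have odd: "genfun ?w ?e {(i, j). even (i + j)} = genfun ?w ?e {(i, j). odd (i + j)}"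
    by (rule genfun_reindex) (auto simp: triangle_reflect)
  have *: "genfun ?w ?e UNIV = genfun ?w ?e {(i, j). even (i + j)} + genfun ?w ?e {(i, j). odd (i + j)}"
    using genfun_split[OF fin, of ?w "\<lambda>(i, j). even (i + j)"] by (simp add: case_prod_unfold)
  then show ?thesis
    unfolding sq * odd[symmetric] even by (simp add: mult.assoc)
qed

text \<open>
  Completing squares in the products of theta series below turns an exponent \<open>m\<close> into the equation
  \<open>u\<^sup>2 + 5 v\<^sup>2 = 4 m + 1\<close>, for which \<open>u + v\<close> must be odd.
\<close>

definition qform_exp :: "int \<times> int \<Rightarrow> int" where
  "qform_exp = (\<lambda>(u, v). (u * u + 5 * (v * v) - 1) div 4)"

lemma qform_exp_eq: "u * u + 5 * (v * v) - 1 = 4 * m \<Longrightarrow> qform_exp (u, v) = m"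
  by (simp add: qform_exp_def)

lemma square_theta5_triangle_theta2:
  shows "square_theta 5 * triangle_theta 2 = genfun (alt_sign \<circ> snd) qform_exp {(u, v). odd u \<and> even v}"
    and "finite_levels qform_exp {(u, v). odd u \<and> even v}"
proof -
  let ?e = "\<lambda>(i, j). int 5 * (i * i) + int 2 * triangle j"
  have prod: "square_theta 5 * triangle_theta 2 = genfun (\<lambda>(i, j). 1 * 1) ?e UNIV"
    and fin: "finite_levels ?e UNIV"
    unfolding square_theta_def triangle_theta_def
    by (intro genfun_mult_UNIV levels_square levels_triangle; simp add: triangle_nonneg)+
  have bij: "bij_betw (\<lambda>(i, j). (2 * j + 1, 2 * i)) UNIV {(u :: int, v :: int). odd u \<and> even v}"
    by (rule bij_betw_byWitness[where f' = "\<lambda>(u, v). (v div 2, u div 2)"]) auto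
  have "qform_exp (2 * j + 1, 2 * i) = 5 * (i * i) + 2 * triangle j" for i j
    by (rule qform_exp_eq) (use two_times_triangle[of j] in algebra)
  then have e: "qform_exp (case p of (i, j) \<Rightarrow> (2 * j + 1, 2 * i)) = ?e p" for p
    by (simp split: prod.split)
  show "square_theta 5 * triangle_theta 2 = genfun (alt_sign \<circ> snd) qform_exp {(u, v). odd u \<and> even v}"
    unfolding prod by (rule genfun_reindex[OF bij]) (simp_all only: e, auto simp: alt_sign_def)
  have "finite_levels ?e UNIV \<longleftrightarrow> finite_levels qform_exp {(u, v). odd u \<and> even v}"
    by (rule finite_levels_reindex[OF bij]) (rule e)
  then show "finite_levels qform_exp {(u, v). odd u \<and> even v}"
    using fin by simp
qed

lemma X_square_theta1_triangle_theta10: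
  shows "fps_X * (square_theta 1 * triangle_theta 10) = - genfun (alt_sign \<circ> snd) qform_exp {(u, v). even u \<and> odd v}"
    and "finite_levels qform_exp {(u, v). even u \<and> odd v}"
proof -
  let ?e = "\<lambda>(i, j). int 1 * (i * i) + int 10 * triangle j"
  have prod: "square_theta 1 * triangle_theta 10 = genfun (\<lambda>(i, j). 1 * 1) ?e UNIV"
    and fin: "finite_levels ?e UNIV"
    unfolding square_theta_def triangle_theta_def
    by (intro genfun_mult_UNIV levels_square levels_triangle; simp add: triangle_nonneg)+
  have bij: "bij_betw (\<lambda>(i, j). (2 * i, 2 * j + 1)) UNIV {(u :: int, v :: int). even u \<and> odd v}"
    by (rule bij_betw_byWitness[where f' = "\<lambda>(u, v). (u div 2, v div 2)"]) auto
  have "qform_exp (2 * i, 2 * j + 1) = i * i + 10 * triangle j + 1" for i j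
    by (rule qform_exp_eq) (use two_times_triangle[of j] in algebra)
  then have e: "qform_exp (case p of (i, j) \<Rightarrow> (2 * i, 2 * j + 1)) = ?e p + int 1" for p
    by (simp split: prod.split)
  have "fps_X ^ 1 * genfun (\<lambda>(i, j). 1 * 1) ?e UNIV = genfun (\<lambda>(i, j). 1 * 1) (\<lambda>p. ?e p + int 1) UNIV"
    by (rule genfun_shift) (auto simp: triangle_nonneg)
  also have "\<dots> = genfun (\<lambda>p. - (alt_sign \<circ> snd) p) qform_exp {(u, v). even u \<and> odd v}"
    by (rule genfun_reindex[OF bij]) (simp_all only: e, auto simp: alt_sign_def)
  finally show "fps_X * (square_theta 1 * triangle_theta 10) =
      - genfun (alt_sign \<circ> snd) qform_exp {(u, v). even u \<and> odd v}"
    by (simp only: prod genfun_uminus power_one_right)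
  have "finite_levels (\<lambda>p. ?e p + int 1) UNIV \<longleftrightarrow> finite_levels qform_exp {(u, v). even u \<and> odd v}"
    by (rule finite_levels_reindex[OF bij]) (rule e)
  moreover have "finite_levels (\<lambda>p. ?e p + int 1) UNIV"
    unfolding finite_levels_def
  proof
    fix n
    have "{p \<in> UNIV. ?e p + int 1 = int n} \<subseteq> {p. p \<in> UNIV \<and> ?e p = int (n - 1)}"
    proof
      fix p assume "p \<in> {p \<in> UNIV. ?e p + int 1 = int n}"
      moreover have "0 \<le> ?e p"
        by (cases p) (simp add: triangle_nonneg)
      ultimately have "?e p = int n - 1" "1 \<le> n"
        by simp_all
      then show "p \<in> {p. p \<in> UNIV \<and> ?e p = int (n - 1)}"
        by (simp add: of_nat_diff)
    qed
    then show "finite {p \<in> UNIV. ?e p + int 1 = int n}"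
      by (rule finite_subset) (rule finite_levelsD[OF fin])
  qed
  ultimately show "finite_levels qform_exp {(u, v). even u \<and> odd v}"
    by blast
qed

text \<open>
  Completing squares in the pentagonal exponents of \<open>f\<^sub>1 f\<^sub>5\<close> gives \<open>x\<^sup>2 + 5 y\<^sup>2 = 6 (4 m + 1)\<close> with
  \<open>x = 6 a + 1\<close> and \<open>y = 6 b + 1\<close>. As \<open>6\<close> is the norm of \<open>1 + \<surd>-5\<close>, dividing
  \<open>x + y \<surd>-5\<close> by \<open>1 + \<surd>-5\<close> gives \<open>u + v \<surd>-5\<close> of norm \<open>4 m + 1\<close>, with \<open>u = 1 + a + 5 b\<close> and \<open>v = b - a\<close>.
  Since \<open>u + v = y\<close>, these are the pairs with \<open>u + v \<equiv> 1\<close> modulo \<open>6\<close>.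
\<close>

lemma genfun_residue_1: "genfun (alt_sign \<circ> snd) qform_exp {(u, v). (u + v) mod 6 = 1} = euler_f 1 * euler_f 5"
proof -
  let ?e = "\<lambda>(a, b). int 1 * (a * a + triangle a) + int 5 * (b * b + triangle b)"
  have bij: "bij_betw (\<lambda>(a, b). (1 + a + 5 * b, b - a)) UNIV {(u, v). (u + v) mod 6 = (1 :: int)}"
  proof (rule bij_betw_byWitness[where f' = "\<lambda>(u, v). ((u + v) div 6 - v, (u + v) div 6)"])
    show "\<forall>p\<in>{(u, v). (u + v) mod 6 = (1 :: int)}.
        (case case p of (u, v) \<Rightarrow> ((u + v) div 6 - v, (u + v) div 6) of
          (a, b) \<Rightarrow> (1 + a + 5 * b, b - a)) = p"
    proof
      fix p :: "int \<times> int" assume "p \<in> {(u, v). (u + v) mod 6 = 1}"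
      then obtain u v where p: "p = (u, v)" and uv: "(u + v) mod 6 = 1"
        by auto
      have "u + v = 6 * ((u + v) div 6) + 1"
        using mult_div_mod_eq[of 6 "u + v"] uv by simp
      then show "(case case p of (u, v) \<Rightarrow> ((u + v) div 6 - v, (u + v) div 6) of
          (a, b) \<Rightarrow> (1 + a + 5 * b, b - a)) = p"
        by (simp add: p)
    qed
  qed (auto simp: algebra_simps)
  have "euler_f 1 * euler_f 5 = genfun (\<lambda>(a, b). alt_sign a * alt_sign b) ?e UNIV"
    by (simp only: euler_f_eq_gf zero_less_one zero_less_numeral)
       (intro genfun_mult_UNIV levels_pentagonal; simp add: triangle_nonneg)
  also have "\<dots> = genfun (alt_sign \<circ> snd) qform_exp {(u, v). (u + v) mod 6 = 1}"
  proof (rule genfun_reindex[OF bij])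
    have "qform_exp (1 + a + 5 * b, b - a) = a * a + triangle a + 5 * (b * b + triangle b)" for a b
      by (rule qform_exp_eq) (use two_times_triangle[of a] two_times_triangle[of b] in algebra)
    then show "qform_exp (case p of (a, b) \<Rightarrow> (1 + a + 5 * b, b - a)) = ?e p" for p
      by (simp split: prod.split)
  qed (auto simp: alt_sign_def)
  finally show ?thesis ..
qed

lemma genfun_residue_5:
  "genfun (alt_sign \<circ> snd) qform_exp {(u, v). (u + v) mod 6 = 5} =
    genfun (alt_sign \<circ> snd) qform_exp {(u, v). (u + v) mod 6 = 1}"
proof (rule genfun_reindex[of "\<lambda>(u, v). (- u, - v)"])
  show "bij_betw (\<lambda>(u, v). (- u, - v)) {(u, v). (u + v) mod 6 = 5} {(u, v). (u + v) mod 6 = (1 :: int)}"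
    by (rule bij_betw_byWitness[where f' = "\<lambda>(u, v). (- u, - v)"]) (auto, presburger+)
qed (auto simp: qform_exp_def alt_sign_def)

text \<open>
  For \<open>u + v = 3 t\<close> with \<open>t\<close> odd, both components of \<open>(1 + \<surd>-5) (u + v \<surd>-5)\<close> are odd multiples of
  \<open>3\<close>, so its conjugate is divisible by \<open>1 + \<surd>-5\<close> as well. The quotient is \<open>h (u, v)\<close>. This
  involution preserves the norm and reverses the sign, because it replaces \<open>v\<close> by \<open>v - t\<close>.
\<close>

lemma genfun_residue_3: "genfun (alt_sign \<circ> snd) qform_exp {(u, v). (u + v) mod 6 = 3} = 0"
proof -
  let ?S = "{(u, v). (u + v) mod 6 = (3 :: int)}"
  define h where "h = (\<lambda>(u, v). (u - 5 * ((u + v) div 3), v - (u + v) div 3 :: int))"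
  have S: "\<exists>t v. p = (3 * t - v, v) \<and> odd t" if p: "p \<in> ?S" for p
  proof -
    obtain u v where uv: "p = (u, v)" by fastforce
    have "s = 3 * (s div 3)" "odd (s div 3)" if "s mod 6 = 3" for s :: int
      using that by presburger+
    from this[of "u + v"] have "u + v = 3 * ((u + v) div 3)" "odd ((u + v) div 3)"
      using p uv by auto
    then have "p = (3 * ((u + v) div 3) - v, v)"
      by (simp add: uv)
    then show ?thesis
      using \<open>odd ((u + v) div 3)\<close> by blast
  qed
  have h: "h (3 * t - v, v) = (3 * (- t) - (v - t), v - t)" for t v
    by (simp add: h_def)
  have h_in: "h p \<in> ?S" and h_h: "h (h p) = p" and e: "qform_exp (h p) = qform_exp p"
    and w: "(alt_sign \<circ> snd) (h p) = - (alt_sign \<circ> snd) p" if p_in: "p \<in> ?S" for p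
  proof -
    obtain t v where p: "p = (3 * t - v, v)" and t: "odd t"
      using S[OF p_in] by blast
    show "h p \<in> ?S"
      using t unfolding p h by (auto, presburger)
    show "h (h p) = p"
      unfolding p h by simp
    show "qform_exp (h p) = qform_exp p"
      unfolding p h by (simp add: qform_exp_def algebra_simps)
    show "(alt_sign \<circ> snd) (h p) = - (alt_sign \<circ> snd) p"
      using t unfolding p h by (simp add: alt_sign_def)
  qed
  have inv: "\<forall>p\<in>?S. h (h p) = p"
    by (rule ballI) (rule h_h)
  have image: "h ` ?S \<subseteq> ?S"
    by (rule image_subsetI) (rule h_in)
  have "bij_betw h ?S ?S"
    by (rule bij_betw_byWitness[OF inv inv image image])
  then have "genfun (\<lambda>p. - (alt_sign \<circ> snd) p) qform_exp ?S = genfun (alt_sign \<circ> snd) qform_exp ?S"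
    by (rule genfun_reindex) (use e w in auto)
  then have "- genfun (alt_sign \<circ> snd) qform_exp ?S = genfun (alt_sign \<circ> snd) qform_exp ?S"
    by (simp only: genfun_uminus)
  moreover have "x = 0" if "- x = x" for x :: "int fps"
    using that by (simp add: fps_eq_iff)
  ultimately show ?thesis
    by blast
qed

text \<open>
  Ramanujan's identity \<open>\<phi>(q\<^sup>5) \<psi>(q\<^sup>2) - q \<phi>(q) \<psi>(q\<^sup>10) = f\<^sub>1 f\<^sub>5\<close>. Twice the left-hand side counts the
  representations \<open>u\<^sup>2 + 5 v\<^sup>2 = 4 m + 1\<close> with sign \<open>(-1)\<^sup>v\<close>. Sorted by the residue of \<open>u + v\<close> modulo
  \<open>6\<close>, the classes \<open>1\<close> and \<open>5\<close> each give \<open>f\<^sub>1 f\<^sub>5\<close>, while the class \<open>3\<close> cancels.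
\<close>

theorem theta_difference:
  "square_theta 5 * triangle_theta 2 - fps_X * (square_theta 1 * triangle_theta 10) = 2 * euler_f 1 * euler_f 5"
proof -
  let ?g = "genfun (alt_sign \<circ> snd) qform_exp"
  let ?R = "\<lambda>r. {(u, v). (u + v) mod 6 = (r :: int)}"
  let ?A = "{(u :: int, v :: int). odd u \<and> even v}" and ?B = "{(u :: int, v :: int). even u \<and> odd v}"
  have parts: "?A \<union> ?B = ?R 1 \<union> (?R 5 \<union> ?R 3)"
    by (auto, presburger+)
  have fin: "finite_levels qform_exp (?A \<union> ?B)"
    by (intro finite_levels_Un square_theta5_triangle_theta2 X_square_theta1_triangle_theta10)
  have fin': "finite_levels qform_exp (?R 1 \<union> (?R 5 \<union> ?R 3))"
    using fin unfolding parts .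
  have "square_theta 5 * triangle_theta 2 - fps_X * (square_theta 1 * triangle_theta 10) = ?g ?A + ?g ?B"
    by (simp only: square_theta5_triangle_theta2(1) X_square_theta1_triangle_theta10(1) diff_minus_eq_add)
  also have "\<dots> = ?g (?A \<union> ?B)"
    by (rule genfun_Un[symmetric, OF fin]) auto
  also have "\<dots> = ?g (?R 1) + ?g (?R 5 \<union> ?R 3)"
    unfolding parts by (rule genfun_Un[OF fin']) auto
  also have "?g (?R 5 \<union> ?R 3) = ?g (?R 5) + ?g (?R 3)"
    by (rule genfun_Un[OF finite_levels_subset[OF fin']]) auto
  finally show ?thesis
    by (simp only: genfun_residue_1 genfun_residue_5 genfun_residue_3 mult.assoc mult_2[of "euler_f 1 * euler_f 5"] add_0_right)
qed

section \<open>The 2-dissection and the recurrence\<close>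

abbreviation dilate :: "int fps \<Rightarrow> int fps" where
  "dilate F \<equiv> F oo fps_X ^ 2"

lemma dilate_mult: "dilate (F * G) = dilate F * dilate G"
  by (rule fps_compose_mult_distrib) simp

lemma dilate_power: "dilate (F ^ n) = dilate F ^ n"
  by (rule fps_compose_power[symmetric]) simp

lemma dilate_X: "dilate fps_X = fps_X ^ 2"
  by simp

lemma dilate_thetas:
  shows "dilate (square_theta k) = square_theta (2 * k)"
    and "dilate (triangle_theta k) = triangle_theta (2 * k)"
  unfolding square_theta_def triangle_theta_def by (rule genfun_dilate; simp)+

lemma dilate_euler_f: "k > 0 \<Longrightarrow> dilate (euler_f k) = euler_f (2 * k)"
  by (simp only: euler_f_eq_gf nat_0_less_mult_iff zero_less_numeral simp_thms) (rule genfun_dilate; simp)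

text \<open>
  By Gauss, \<open>G = \<phi>(-q)\<^sup>2 \<phi>(-q\<^sup>5)\<^sup>2 f\<^sub>2\<^sup>2 f\<^sub>10\<^sup>2\<close>. The dissections of the two theta squares show that, after
  \<open>q\<^sup>2\<close> is replaced by \<open>q\<close>, the odd part of \<open>G\<close> is
  \<open>-4 (\<psi>(q\<^sup>2)\<^sup>2 \<phi>(q\<^sup>5)\<^sup>2 + q\<^sup>2 \<phi>(q)\<^sup>2 \<psi>(q\<^sup>10)\<^sup>2) f\<^sub>1\<^sup>2 f\<^sub>5\<^sup>2\<close>. This sum of two squares is the square of
  Ramanujan's difference plus \<open>2 q \<psi>(q)\<^sup>2 \<psi>(q\<^sup>5)\<^sup>2\<close>; the former is \<open>f\<^sub>1\<^sup>2 f\<^sub>5\<^sup>2\<close>, and the latter is again a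
  quotient of Euler products.
\<close>

lemma two_dissection:
  fixes G :: "int fps"
  defines "G \<equiv> euler_f 1 ^ 4 * euler_f 5 ^ 4"
  shows "\<exists>A. G = dilate A - fps_X * dilate (4 * G + 8 * fps_X * dilate G)"
proof -
  define f1 f2 f5 f10 where f: "f1 = euler_f 1" "f2 = euler_f 2" "f5 = euler_f 5" "f10 = euler_f 10"
  define p1 p5 t2 t10 where pt: "p1 = square_theta 1" "p5 = square_theta 5"
    "t2 = triangle_theta 2" "t10 = triangle_theta 10"
  define t1 t5 where t15: "t1 = triangle_theta 1" "t5 = triangle_theta 5"
  define a1 a5 where a: "a1 = alt_square_theta 1" "a5 = alt_square_theta 5"
  have af: "a1 * f2 = f1 ^ 2" "a5 * f10 = f5 ^ 2"
    using alt_square_theta_mult_euler_f[of 1] alt_square_theta_mult_euler_f[of 5] by (simp_all add: a f)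
  have a2: "a1 ^ 2 = dilate (p1 ^ 2) - fps_X * dilate (t2 ^ 2)"
      "a5 ^ 2 = dilate (p5 ^ 2) - fps_X ^ 5 * dilate (t10 ^ 2)"
    using alt_square_theta_power2[of 1] alt_square_theta_power2[of 5]
    by (simp_all add: a pt dilate_power dilate_thetas)
  have tf: "t1 * f1 = 2 * f2 ^ 2" "t5 * f5 = 2 * f10 ^ 2"
    using triangle_theta_mult_euler_f[of 1] triangle_theta_mult_euler_f[of 5] by (simp_all add: t15 f)
  have t2: "t1 ^ 2 = 2 * t2 * p1" "t5 ^ 2 = 2 * t10 * p5"
    using triangle_theta_power2[of 1] triangle_theta_power2[of 5] by (simp_all add: t15 pt)
  have diff: "p5 * t2 - fps_X * (p1 * t10) = 2 * f1 * f5"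
    using theta_difference by (simp add: pt f)
  have df: "dilate f1 = f2" "dilate f5 = f10"
    using dilate_euler_f[of 1] dilate_euler_f[of 5] by (simp_all add: f)
  have G: "G = f1 ^ 4 * f5 ^ 4"
    by (simp add: G_def f)
  have dG: "dilate G = f2 ^ 4 * f10 ^ 4"
    by (simp only: G dilate_mult dilate_power df)
  \<comment> \<open>Since \<open>triangle_theta\<close> is twice Ramanujan's \<open>\<psi>\<close>, the factor \<open>4\<close> is already contained in the squares.\<close>
  have sum_sq: "(t2 ^ 2 * p5 ^ 2 + fps_X ^ 2 * p1 ^ 2 * t10 ^ 2) * (f1 * f5) ^ 2 = 4 * G + 8 * fps_X * dilate G"
  proof -
    have "2 * ((t2 ^ 2 * p5 ^ 2 + fps_X ^ 2 * p1 ^ 2 * t10 ^ 2) * (f1 * f5) ^ 2) =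
        2 * (p5 * t2 - fps_X * (p1 * t10)) ^ 2 * (f1 * f5) ^ 2 +
        fps_X * ((2 * t2 * p1) * f1 ^ 2) * ((2 * t10 * p5) * f5 ^ 2)"
      by (simp add: power2_eq_square algebra_simps)
    also have "\<dots> = 2 * (2 * f1 * f5) ^ 2 * (f1 * f5) ^ 2 + fps_X * (t1 * f1) ^ 2 * (t5 * f5) ^ 2"
      unfolding diff t2[symmetric] by (simp add: power_mult_distrib)
    also have "\<dots> = 2 * (4 * G + 8 * fps_X * dilate G)"
      unfolding tf dG unfolding G by (simp add: power_mult_distrib power_mult[symmetric] algebra_simps flip: power_add)
    finally show ?thesis
      by (metis mult_cancel_left zero_neq_numeral)
  qed
  have "G = a1 ^ 2 * a5 ^ 2 * (f2 * f10) ^ 2"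
  proof -
    have "G = (f1 ^ 2) ^ 2 * (f5 ^ 2) ^ 2"
      by (simp add: G flip: power_mult)
    then show ?thesis
      by (simp only: af[symmetric] power_mult_distrib mult_ac)
  qed
  also have "\<dots> = (dilate (p1 ^ 2) * dilate (p5 ^ 2) + fps_X ^ 6 * dilate (t2 ^ 2) * dilate (t10 ^ 2)) * (f2 * f10) ^ 2 -
      fps_X * ((dilate (t2 ^ 2) * dilate (p5 ^ 2) + fps_X ^ 4 * dilate (p1 ^ 2) * dilate (t10 ^ 2)) * (f2 * f10) ^ 2)"
    unfolding a2 by (simp add: algebra_simps flip: power_add power_Suc)
       (simp add: numeral_eq_Suc mult_ac)
  also have "(dilate (p1 ^ 2) * dilate (p5 ^ 2) + fps_X ^ 6 * dilate (t2 ^ 2) * dilate (t10 ^ 2)) * (f2 * f10) ^ 2 =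
      dilate ((p1 ^ 2 * p5 ^ 2 + fps_X ^ 3 * t2 ^ 2 * t10 ^ 2) * (f1 * f5) ^ 2)"
    by (simp only: fps_compose_add_distrib dilate_mult dilate_power df dilate_X power_mult[symmetric]) simp
  also have "(dilate (t2 ^ 2) * dilate (p5 ^ 2) + fps_X ^ 4 * dilate (p1 ^ 2) * dilate (t10 ^ 2)) * (f2 * f10) ^ 2 =
      dilate ((t2 ^ 2 * p5 ^ 2 + fps_X ^ 2 * p1 ^ 2 * t10 ^ 2) * (f1 * f5) ^ 2)"
    by (simp only: fps_compose_add_distrib dilate_mult dilate_power df dilate_X power_mult[symmetric]) simp
  finally show ?thesis
    unfolding sum_sq by blast
qed

text \<open>
  The eigenform relation of the Hecke operator \<open>T\<^sub>2\<close> in weight \<open>4\<close>, with eigenvalue \<open>-4\<close>.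
\<close>

lemma Pstar_recurrence:
  "Pstar (2 * n + 1) = - 4 * Pstar n - 8 * (if odd n then Pstar (n div 2) else 0)"
proof -
  define G where "G = euler_f 1 ^ 4 * euler_f 5 ^ 4"
  have P: "Pstar m = fps_nth G m" for m
    by (simp add: Pstar_def G_def)
  obtain A where A: "G = dilate A - fps_X * dilate (4 * G + 8 * fps_X * dilate G)"
    using two_dissection unfolding G_def by blast
  have "fps_nth G (2 * n + 1) = - fps_nth (4 * G + 8 * fps_X * dilate G) n"
    by (subst A) (simp add: fps_nth_compose_X_power)
  also have "4 * G + 8 * fps_X * dilate G = fps_const 4 * G + fps_const 8 * (fps_X * dilate G)"
    by (simp add: numeral_fps_const mult.assoc)
  also have "fps_nth \<dots> n = 4 * fps_nth G n + 8 * (if odd n then fps_nth G (n div 2) else 0)"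
    by (auto simp: fps_nth_compose_X_power elim!: oddE)
  finally show ?thesis
    by (simp add: P)
qed

theorem theorem1:
  "(\<forall>n. [Pstar (2 * n + 1) = 0] (mod 4)) \<and>
   (\<forall>n. [Pstar (4 * n + 3) = 0] (mod 8)) \<and>
   (\<forall>n. Pstar (16 * n + 7) = 0)"
proof (intro conjI allI)
  fix n
  have dvd: "4 dvd Pstar (2 * n + 1)"
    unfolding Pstar_recurrence by simp
  then show "[Pstar (2 * n + 1) = 0] (mod 4)"
    by (simp add: cong_0_iff)
  have odd_index: "Pstar (4 * m + 3) = - 4 * Pstar (2 * m + 1) - 8 * Pstar m" for m
  proof -
    have "2 * (2 * m + 1) + 1 = 4 * m + 3" "(2 * m + 1) div 2 = m" "odd (2 * m + 1)"
      by simp_all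
    then show ?thesis
      using Pstar_recurrence[of "2 * m + 1"] by metis
  qed
  obtain c where "Pstar (2 * n + 1) = 4 * c"
    using dvd ..
  then show "[Pstar (4 * n + 3) = 0] (mod 8)"
    unfolding odd_index by (simp add: cong_0_iff)
  have "Pstar (16 * n + 7) = - 4 * Pstar (8 * n + 3) - 8 * Pstar (4 * n + 1)"
  proof -
    have "4 * (4 * n + 1) + 3 = 16 * n + 7" "2 * (4 * n + 1) + 1 = 8 * n + 3"
      by simp_all
    then show ?thesis
      using odd_index[of "4 * n + 1"] by metis
  qed
  also have "Pstar (8 * n + 3) = - 4 * Pstar (4 * n + 1) - 8 * Pstar (2 * n)"
    using odd_index[of "2 * n"] by simp
  also have "Pstar (4 * n + 1) = - 4 * Pstar (2 * n)"
    using Pstar_recurrence[of "2 * n"] by simp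
  \<comment> \<open>The contributions \<open>- 4 * (16 - 8)\<close> and \<open>- 8 * (- 4)\<close> cancel:
    this is the vanishing of the Hecke eigenvalue at \<open>8\<close>.\<close>
  finally show "Pstar (16 * n + 7) = 0"
    by simp
qed

end
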